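(* Let $n \geq 1$, let $\Omega \subseteq \mathbb{R}^n$ be open, and let $f = f(z_1, \dots, z_n) : \Omega \to \mathbb{R}$ be a $C^2$ function satisfying $$\Delta f = 0 \quad \text{and} \quad \Delta_\infty f = 0 .$$ Then: (1) The graph $z_{n+1} = f(z_1, \dots, z_n)$ is a minimal hypersurface in $\mathbb{R}^{n+1}$. (2) The graph $z_{n+1} = z_0 \tan f(z_1, \dots, z_n)$, over the set of $(z_0, z_1, \dots, z_n) \in \mathbb{R} \times \Omega$ where $\tan f$ is defined, is a minimal hypersurface in $\mathbb{R}^{n+2}$ (with coordinates $(z_0, z_1, \dots, z_n, z_{n+1})$).
   Context: $\Delta$ is the Euclidean Laplacian. The infinity Laplacian of a $C^2$ function $F$ on an open subset of $\mathbb{R}^N$ is $$\Delta_\infty F := \left\langle \nabla F, \nabla\left(\tfrac12 \|\nabla F\|^2\right)\right\rangle = \sum_{i,j=1}^{N} \frac{\partial F}{\partial z_i}\frac{\partial F}{\partial z_j}\frac{\partial^2 F}{\partial z_i \partial z_j}.$$ A hypersurface in Euclidean space is minimal if its mean curvature vanishes identically; for the graph of a $C^2$ function $u$ this means $\nabla\cdot\left( \nabla u / \sqrt{1+\|\nabla u\|^2}\right) = 0$. *)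

theory Defs
  imports "HOL-Analysis.Analysis"
begin

definition gradient :: "('a::euclidean_space \<Rightarrow> real) \<Rightarrow> 'a \<Rightarrow> 'a" where
  "gradient F x = (THE D. GDERIV F x :> D)"

(* Continuity of the second derivative H is meant in the operator norm. *)
definition C2_on :: "'a::euclidean_space set \<Rightarrow> ('a \<Rightarrow> real) \<Rightarrow> bool" where
  "C2_on S F \<longleftrightarrow> open S \<and>
     (\<exists>(g :: 'a \<Rightarrow> 'a) (H :: 'a \<Rightarrow> 'a \<Rightarrow>\<^sub>L 'a).
        (\<forall>x\<in>S. GDERIV F x :> g x) \<and>
        (\<forall>x\<in>S. (g has_derivative blinfun_apply (H x)) (at x)) \<and>
        continuous_on S H)"

definition divergence :: "('a::euclidean_space \<Rightarrow> 'a) \<Rightarrow> 'a \<Rightarrow> real" where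
  "divergence V x = (\<Sum>b\<in>Basis. frechet_derivative V (at x) b \<bullet> b)"

definition laplacian :: "('a::euclidean_space \<Rightarrow> real) \<Rightarrow> 'a \<Rightarrow> real" where
  "laplacian F x = divergence (gradient F) x"

definition infinity_laplacian :: "('a::euclidean_space \<Rightarrow> real) \<Rightarrow> 'a \<Rightarrow> real" where
  "infinity_laplacian F x = gradient F x \<bullet> gradient (\<lambda>y. 1/2 * (norm (gradient F y))\<^sup>2) x"

definition unit_normal :: "('a::euclidean_space \<Rightarrow> real) \<Rightarrow> 'a \<Rightarrow> 'a" where
  "unit_normal F x = gradient F x /\<^sub>R norm (gradient F x)"

(* Mean curvature, at x, of the level set of F through x, with respect to the unit normal
   grad F / |grad F|: the trace of the shape operator divided by the dimension of the
   hypersurface. The full divergence is the trace over the tangent space alone, since the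
   derivative of a unit vector field in the normal direction has no normal component. *)
definition mean_curvature :: "('a::euclidean_space \<Rightarrow> real) \<Rightarrow> 'a \<Rightarrow> real" where
  "mean_curvature F x = - divergence (unit_normal F) x / (real DIM('a) - 1)"

definition local_equation :: "'a::euclidean_space set \<Rightarrow> 'a set \<Rightarrow> ('a \<Rightarrow> real) \<Rightarrow> bool" where
  "local_equation S U F \<longleftrightarrow>
     C2_on U F \<and> (\<forall>x\<in>U. gradient F x \<noteq> 0) \<and> S \<inter> U = {x\<in>U. F x = 0}"

(* Replacing a local equation by another one changes the mean curvature at most by its sign,
   so whether it vanishes does not depend on the choice. *)
definition minimal_hypersurface :: "'a::euclidean_space set \<Rightarrow> bool" where
  "minimal_hypersurface S \<longleftrightarrow>
     (\<forall>p\<in>S. \<exists>U F. p \<in> U \<and> local_equation S U F \<and> (\<forall>x\<in>S \<inter> U. mean_curvature F x = 0))"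

definition graph_on :: "'a set \<Rightarrow> ('a \<Rightarrow> real) \<Rightarrow> ('a \<times> real) set" where
  "graph_on D u = {(x, u x) | x. x \<in> D}"


lemma GDERIV_unique:
  fixes F :: "'a::euclidean_space \<Rightarrow> real"
  assumes "GDERIV F x :> D" "GDERIV F x :> E"
  shows "D = E"
proof -
  have "(\<lambda>h. h \<bullet> D) = (\<lambda>h. h \<bullet> E)"
    using assms unfolding gderiv_def by (rule has_derivative_unique)
  then show ?thesis by (metis euclidean_eqI inner_commute)
qed

lemma gradient_eqI: "GDERIV F x :> D \<Longrightarrow> gradient F x = D"
  unfolding gradient_def by (blast intro: GDERIV_unique)

lemma divergence_eqI:
  assumes "(V has_derivative V') (at x)"
  shows "divergence V x = (\<Sum>b\<in>Basis. V' b \<bullet> b)"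
  using frechet_derivative_at[OF assms] by (simp add: divergence_def)

lemma C2_on_gderiv:
  assumes "C2_on S F" "x \<in> S"
  shows "GDERIV F x :> gradient F x"
proof -
  obtain g where "\<forall>x\<in>S. GDERIV F x :> g x" using assms(1) unfolding C2_on_def by blast
  then have "GDERIV F x :> g x" using assms(2) by blast
  then show ?thesis using gradient_eqI by metis
qed

lemma C2_on_has_derivative:
  assumes "C2_on S F" "x \<in> S"
  shows "(F has_derivative (\<lambda>h. h \<bullet> gradient F x)) (at x)"
  using C2_on_gderiv[OF assms] by (simp only: gderiv_def)

lemma C2_onE:
  fixes F :: "'a::euclidean_space \<Rightarrow> real"
  assumes "C2_on S F"
  obtains H :: "'a \<Rightarrow> 'a \<Rightarrow>\<^sub>L 'a" where
    "\<And>x. x \<in> S \<Longrightarrow> (gradient F has_derivative blinfun_apply (H x)) (at x)"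
    "continuous_on S H"
proof -
  from assms obtain g H where op: "open S" and g: "\<forall>x\<in>S. GDERIV F x :> g x"
    and H: "\<forall>x\<in>S. (g has_derivative blinfun_apply (H x)) (at x)" and c: "continuous_on S H"
    unfolding C2_on_def by blast
  have eq: "gradient F x = g x" if "x \<in> S" for x using g that gradient_eqI by blast
  have H': "(gradient F has_derivative blinfun_apply (H x)) (at x)" if x: "x \<in> S" for x
    by (rule has_derivative_transform_within_open[OF bspec[OF H x] op x]) (simp add: eq)
  show thesis by (rule that[OF H' c])
qed

lemma C2_on_continuous_gradient:
  assumes "C2_on S F"
  shows "continuous_on S (gradient F)"
proof -
  obtain H where H: "\<And>x. x \<in> S \<Longrightarrow> (gradient F has_derivative blinfun_apply (H x)) (at x)"
    by (rule C2_onE[OF assms]) (rule that)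
  show ?thesis
    by (rule has_derivative_continuous_on[OF has_derivative_at_withinI[OF H]])
qed

(* For graphs, the notion above is the usual minimal surface equation. *)

lemma unit_normal_differentiable:
  fixes F :: "'a::euclidean_space \<Rightarrow> real"
  assumes "C2_on S F" "x \<in> S" "gradient F x \<noteq> 0"
  shows "unit_normal F differentiable (at x)"
proof -
  obtain H :: "'a \<Rightarrow> 'a \<Rightarrow>\<^sub>L 'a"
    where "\<And>x. x \<in> S \<Longrightarrow> (gradient F has_derivative blinfun_apply (H x)) (at x)"
    by (rule C2_onE[OF assms(1)]) (rule that)
  then have H: "(gradient F has_derivative blinfun_apply (H x)) (at x)" using assms(2) .
  have "((\<lambda>y. norm (gradient F y)) has_derivative
      (\<lambda>h. blinfun_apply (H x) h \<bullet> sgn (gradient F x))) (at x)"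
    using has_derivative_compose[OF H, of norm "\<lambda>h. h \<bullet> sgn (gradient F x)"]
      GDERIV_norm[OF assms(3)] by (simp add: gderiv_def)
  then have "(\<lambda>y. inverse (norm (gradient F y))) differentiable (at x)"
    using assms(3) by (intro differentiable_inverse) (auto simp: differentiable_def)
  moreover have "gradient F differentiable (at x)" using H differentiable_def by blast
  ultimately show ?thesis
    unfolding unit_normal_def[abs_def] by (rule differentiable_scaleR)
qed

lemma graph_C2:
  fixes u :: "'a::euclidean_space \<Rightarrow> real"
  assumes u: "C2_on D u"
  defines "G \<equiv> \<lambda>p::'a \<times> real. snd p - u (fst p)"
  shows "C2_on (D \<times> UNIV) G"
    and "p \<in> D \<times> UNIV \<Longrightarrow> gradient G p = (- gradient u (fst p), 1)"
proof -
  obtain H :: "'a \<Rightarrow> 'a \<Rightarrow>\<^sub>L 'a" where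
    H: "\<And>x. x \<in> D \<Longrightarrow> (gradient u has_derivative blinfun_apply (H x)) (at x)"
    and cont: "continuous_on D H"
    by (rule C2_onE[OF u]) (rule that)
  have op: "open D" using u by (simp add: C2_on_def)
  have G: "GDERIV G p :> (- gradient u (fst p), 1)" if "p \<in> D \<times> UNIV" for p
  proof -
    have "fst p \<in> D" using that by auto
    have "(u has_derivative (\<lambda>h. h \<bullet> gradient u (fst p))) (at (fst p))"
      by (rule C2_on_has_derivative[OF u \<open>fst p \<in> D\<close>])
    from has_derivative_compose[OF has_derivative_fst[OF has_derivative_ident] this]
    have "((\<lambda>q. u (fst q)) has_derivative (\<lambda>h. fst h \<bullet> gradient u (fst p))) (at p)"
      by simp
    from has_derivative_diff[OF has_derivative_snd[OF has_derivative_ident] this]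
    show ?thesis
      unfolding gderiv_def G_def
      by (simp add: inner_prod_def)
  qed
  then show "p \<in> D \<times> UNIV \<Longrightarrow> gradient G p = (- gradient u (fst p), 1)"
    using gradient_eqI by blast
  define P :: "('a \<times> real) \<Rightarrow>\<^sub>L 'a" where "P = Blinfun fst"
  define J :: "'a \<Rightarrow>\<^sub>L ('a \<times> real)" where "J = Blinfun (\<lambda>a. (- a, 0))"
  have P: "blinfun_apply P h = fst h" for h
    unfolding P_def by (simp add: bounded_linear_Blinfun_apply bounded_linear_fst)
  have J: "blinfun_apply J h = (- h, 0)" for h
    unfolding J_def by (simp add: bounded_linear_Blinfun_apply bounded_linear_Pair
        bounded_linear_minus bounded_linear_ident bounded_linear_zero)
  have "((\<lambda>q. (- gradient u (fst q), 1)) has_derivative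
      blinfun_apply (J o\<^sub>L H (fst p) o\<^sub>L P)) (at p)" if "p \<in> D \<times> UNIV" for p :: "'a \<times> real"
  proof -
    have "fst p \<in> D" using that by auto
    from has_derivative_compose[OF has_derivative_fst[OF has_derivative_ident] H[OF this]]
    have "((\<lambda>q. gradient u (fst q)) has_derivative (\<lambda>h. H (fst p) (fst h))) (at p)"
      by simp
    from has_derivative_Pair[OF has_derivative_minus[OF this] has_derivative_const[of 1]]
    show ?thesis
      by (rule has_derivative_eq_rhs) (simp add: fun_eq_iff P J)
  qed
  moreover have "continuous_on (D \<times> (UNIV::real set)) (\<lambda>p. H (fst p))"
    by (rule continuous_on_compose2[OF cont continuous_on_fst[OF continuous_on_id]]) auto
  then have "continuous_on (D \<times> (UNIV::real set)) (\<lambda>p. J o\<^sub>L H (fst p) o\<^sub>L P)"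
    by (intro bounded_bilinear.continuous_on[OF bounded_bilinear_blinfun_compose]
        continuous_on_const)
  moreover have "open (D \<times> (UNIV::real set))" using op by (simp add: open_Times)
  ultimately show "C2_on (D \<times> UNIV) G"
    unfolding C2_on_def using G
    by (intro conjI exI[of _ "\<lambda>q. (- gradient u (fst q), 1)"]
        exI[of _ "\<lambda>p. J o\<^sub>L H (fst p) o\<^sub>L P"] ballI)
qed

lemma sum_Basis_prod_real:
  fixes A :: "'a::euclidean_space \<times> real \<Rightarrow> real"
  shows "(\<Sum>b\<in>Basis. A b) = (\<Sum>b\<in>Basis. A (b, 0)) + A (0, 1)"
proof -
  have "inj_on (\<lambda>u::'a. (u, 0::real)) Basis" by (simp add: inj_on_def)
  then show ?thesis
    unfolding Basis_prod_def
    by (subst sum.union_disjoint) (auto simp: sum.reindex)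
qed

lemma graph_divergence:
  fixes u :: "'a::euclidean_space \<Rightarrow> real"
  assumes u: "C2_on D u" and x: "x \<in> D"
  shows "divergence (unit_normal (\<lambda>p. snd p - u (fst p))) (x, u x) =
    - divergence (\<lambda>y. gradient u y /\<^sub>R sqrt (1 + (norm (gradient u y))\<^sup>2)) x"
proof -
  define G where "G = (\<lambda>p::'a \<times> real. snd p - u (fst p))"
  define V where "V = (\<lambda>y. gradient u y /\<^sub>R sqrt (1 + (norm (gradient u y))\<^sup>2))"
  define W where "W = (\<lambda>y. inverse (sqrt (1 + (norm (gradient u y))\<^sup>2)))"
  have op: "open D" using u by (simp add: C2_on_def)
  have GC: "C2_on (D \<times> UNIV) G" and gG: "\<And>p. p \<in> D \<times> UNIV \<Longrightarrow> gradient G p = (- gradient u (fst p), 1)"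
    using graph_C2[OF u] unfolding G_def by auto
  obtain H :: "'a \<Rightarrow> 'a \<Rightarrow>\<^sub>L 'a"
    where "\<And>x. x \<in> D \<Longrightarrow> (gradient u has_derivative blinfun_apply (H x)) (at x)"
    by (rule C2_onE[OF u]) (rule that)
  then have H: "(gradient u has_derivative blinfun_apply (H x)) (at x)" using x .
  have pos: "1 + (norm (gradient u y))\<^sup>2 > 0" for y
    by (simp add: add_pos_nonneg)
  have "\<exists>W'. (W has_derivative W') (at x)"
    unfolding W_def power2_norm_eq_inner
    using H pos[of x] by (auto intro!: exI derivative_eq_intros simp: power2_norm_eq_inner)
  then obtain W' where W': "(W has_derivative W') (at x)" by blast
  have V': "(V has_derivative (\<lambda>h. W x *\<^sub>R H x h + W' h *\<^sub>R gradient u x)) (at x)"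
    unfolding V_def using has_derivative_scaleR[OF W' H] by (simp add: W_def)
  have N: "unit_normal G p = (- V (fst p), W (fst p))" if "p \<in> D \<times> UNIV" for p
    unfolding unit_normal_def gG[OF that]
    by (simp add: V_def W_def norm_prod_def add.commute)
  define V2 where "V2 = (\<lambda>h. W x *\<^sub>R H x h + W' h *\<^sub>R gradient u x)"
  have a: "((\<lambda>q. V (fst q)) has_derivative (\<lambda>h. V2 (fst h))) (at (x, u x))"
    using has_derivative_compose[OF has_derivative_fst[OF has_derivative_ident], of V V2 "(x, u x)" UNIV] V'
    by (simp add: V2_def)
  have b: "((\<lambda>q. W (fst q)) has_derivative (\<lambda>h. W' (fst h))) (at (x, u x))"
    using has_derivative_compose[OF has_derivative_fst[OF has_derivative_ident], of W W' "(x, u x)" UNIV] W'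
    by simp
  have "((\<lambda>q. (- V (fst q), W (fst q))) has_derivative (\<lambda>h. (- V2 (fst h), W' (fst h)))) (at (x, u x))"
    by (intro has_derivative_Pair has_derivative_minus a b)
  then have "(unit_normal G has_derivative (\<lambda>h. (- V2 (fst h), W' (fst h)))) (at (x, u x))"
    by (rule has_derivative_transform_within_open[of _ _ _ _ "D \<times> UNIV"])
      (use op x N in \<open>auto simp: open_Times\<close>)
  then have "divergence (unit_normal G) (x, u x)
      = (\<Sum>b\<in>Basis. (- V2 (fst b), W' (fst b)) \<bullet> b)"
    by (rule divergence_eqI)
  also have "\<dots> = (\<Sum>b\<in>Basis. - (V2 b \<bullet> b)) + W' 0"
    by (simp add: sum_Basis_prod_real)
  also have "W' 0 = 0"
    using W' has_derivative_bounded_linear linear_simps(3) by blast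
  also have "(\<Sum>b\<in>Basis. - (V2 b \<bullet> b)) = - divergence V x"
    using divergence_eqI[OF V'] by (simp add: V2_def sum_negf)
  finally show ?thesis by (simp add: G_def V_def)
qed

lemma local_equation_graph:
  assumes "C2_on D u"
  shows "local_equation (graph_on D u) (D \<times> UNIV) (\<lambda>p. snd p - u (fst p))"
  unfolding local_equation_def
proof (intro conjI ballI)
  show "C2_on (D \<times> UNIV) (\<lambda>p. snd p - u (fst p))" by (rule graph_C2(1)[OF assms])
  show "gradient (\<lambda>p. snd p - u (fst p)) p \<noteq> 0" if "p \<in> D \<times> UNIV" for p
    by (subst graph_C2(2)[OF assms that]) (simp add: zero_prod_def)
  show "graph_on D u \<inter> D \<times> UNIV = {p \<in> D \<times> UNIV. snd p - u (fst p) = 0}"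
    by (force simp: graph_on_def)
qed

lemma local_equation_mean_curvature:
  fixes u :: "'a::euclidean_space \<Rightarrow> real"
  assumes u: "C2_on D u" and F: "local_equation (graph_on D u) U F"
    and x: "x \<in> D" "(x, u x) \<in> U"
    and 0: "divergence (unit_normal F) (x, u x) = 0"
  shows "divergence (unit_normal (\<lambda>p. snd p - u (fst p))) (x, u x) = 0"
proof -
  define G where "G = (\<lambda>p::'a \<times> real. snd p - u (fst p))"
  define \<phi> where "\<phi> = (\<lambda>y. (y, u y))"
  have GC: "C2_on (D \<times> UNIV) G" and gG: "\<And>p. p \<in> D \<times> UNIV \<Longrightarrow> gradient G p = (- gradient u (fst p), 1)"
    using graph_C2[OF u] unfolding G_def by auto
  have FC: "C2_on U F" and F0: "\<And>p. p \<in> U \<Longrightarrow> gradient F p \<noteq> 0"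
    and FZ: "graph_on D u \<inter> U = {p\<in>U. F p = 0}"
    using conjunct1[OF F[unfolded local_equation_def]]
      conjunct2[OF F[unfolded local_equation_def]] by blast+
  have opD: "open D" and opU: "open U" using u FC by (auto simp: C2_on_def)
  have Du: "(u has_derivative (\<lambda>h. h \<bullet> gradient u y)) (at y)" if "y \<in> D" for y
    by (rule C2_on_has_derivative[OF u that])
  have DF: "(F has_derivative (\<lambda>h. h \<bullet> gradient F p)) (at p)" if "p \<in> U" for p
    by (rule C2_on_has_derivative[OF FC that])
  have contF: "continuous_on U (gradient F)" by (rule C2_on_continuous_gradient[OF FC])
  have D\<phi>: "(\<phi> has_derivative (\<lambda>h. (h, h \<bullet> gradient u y))) (at y)" if "y \<in> D" for y
    unfolding \<phi>_def using Du[OF that] by (auto intro!: derivative_eq_intros)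
  have cont\<phi>: "continuous_on D \<phi>"
    by (rule has_derivative_continuous_on[OF has_derivative_at_withinI[OF D\<phi>]])
  define E where "E = D \<inter> \<phi> -` U"
  have opE: "open E" unfolding E_def by (rule continuous_open_preimage[OF cont\<phi> opD opU])
  have xE: "x \<in> E" using x by (simp add: E_def \<phi>_def)
  define c where "c = (\<lambda>y. snd (gradient F (\<phi> y)))"
  have par: "gradient F (\<phi> y) = c y *\<^sub>R (- gradient u y, 1)" if "y \<in> E" for y
  proof -
    have y: "y \<in> D" "\<phi> y \<in> U" using that by (auto simp: E_def)
    have "((\<lambda>z. F (\<phi> z)) has_derivative (\<lambda>h. (h, h \<bullet> gradient u y) \<bullet> gradient F (\<phi> y))) (at y)"
      using has_derivative_compose[OF D\<phi>[OF y(1)] DF[OF y(2)]] .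
    moreover have "((\<lambda>z. F (\<phi> z)) has_derivative (\<lambda>h. 0)) (at y)"
    proof (rule has_derivative_transform_within_open[of "\<lambda>z. 0" _ _ _ E])
      fix z assume "z \<in> E"
      then have "\<phi> z \<in> graph_on D u \<inter> U" by (auto simp: E_def \<phi>_def graph_on_def)
      then show "0 = F (\<phi> z)" using FZ by (metis (mono_tags, lifting) mem_Collect_eq)
    qed (use opE that in auto)
    ultimately have "(\<lambda>h. (h, h \<bullet> gradient u y) \<bullet> gradient F (\<phi> y)) = (\<lambda>h. 0)"
      by (rule has_derivative_unique)
    from fun_cong[OF this]
    have *: "h \<bullet> (fst (gradient F (\<phi> y)) + c y *\<^sub>R gradient u y) = 0" for h
      by (simp add: inner_prod_def c_def inner_add_right mult.commute)
    from *[of "fst (gradient F (\<phi> y)) + c y *\<^sub>R gradient u y"]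
    have "fst (gradient F (\<phi> y)) + c y *\<^sub>R gradient u y = 0"
      by (simp only: inner_eq_zero_iff)
    then show ?thesis by (simp add: prod_eq_iff c_def eq_neg_iff_add_eq_0)
  qed
  have c0: "c y \<noteq> 0" if "y \<in> E" for y
    using par[OF that] F0[of "\<phi> y"] that by (auto simp: E_def zero_prod_def)
  have contc: "continuous_on E c"
    unfolding c_def
    by (intro continuous_intros continuous_on_compose2[OF contF] continuous_on_subset[OF cont\<phi>])
      (auto simp: E_def)
  define s where "s = sgn (c x)"
  define E' where "E' = E \<inter> (\<lambda>y. c y * s) -` {0<..}"
  have opE': "open E'"
    unfolding E'_def
    by (intro continuous_open_preimage opE open_greaterThan continuous_intros contc)
  have xE': "x \<in> E'" using xE c0[OF xE] by (auto simp: E'_def s_def sgn_if)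
  have N: "unit_normal F (\<phi> y) = s *\<^sub>R unit_normal G (\<phi> y)" if "y \<in> E'" for y
  proof -
    have yE: "y \<in> E" and cs: "c y * s > 0" using that by (auto simp: E'_def)
    have s: "s = sgn (c y)" using cs unfolding s_def
      by (auto simp: sgn_if zero_less_mult_iff split: if_splits)
    have "gradient G (\<phi> y) = (- gradient u y, 1)"
      using gG[of "\<phi> y"] yE by (simp add: E_def \<phi>_def)
    then have gF: "gradient F (\<phi> y) = c y *\<^sub>R gradient G (\<phi> y)" using par[OF yE] by simp
    show ?thesis unfolding unit_normal_def gF s
      by (simp add: sgn_real_def abs_if)
  qed
  obtain NF where NF: "(unit_normal F has_derivative NF) (at (\<phi> x))"
    using unit_normal_differentiable[OF FC _ F0] x unfolding differentiable_def \<phi>_def by blast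
  have gx: "gradient G (\<phi> x) = (- gradient u x, 1)" using gG[of "\<phi> x"] x by (simp add: \<phi>_def)
  obtain NG where NG: "(unit_normal G has_derivative NG) (at (\<phi> x))"
    using unit_normal_differentiable[OF GC, of "\<phi> x"] x gx
    unfolding differentiable_def \<phi>_def by (auto simp: zero_prod_def)
  define n where "n = unit_normal G (\<phi> x)"
  have unit: "L h \<bullet> unit_normal K (\<phi> x) = 0"
    if L: "(unit_normal K has_derivative L) (at (\<phi> x))" and T: "open T" "\<phi> x \<in> T"
      and nz: "\<And>p. p \<in> T \<Longrightarrow> gradient K p \<noteq> 0" for K L T h
  proof -
    have "((\<lambda>p. unit_normal K p \<bullet> unit_normal K p) has_derivative
        (\<lambda>h. unit_normal K (\<phi> x) \<bullet> L h + L h \<bullet> unit_normal K (\<phi> x))) (at (\<phi> x))"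
      by (rule has_derivative_inner[OF L L])
    moreover have "((\<lambda>p. unit_normal K p \<bullet> unit_normal K p) has_derivative (\<lambda>h. 0)) (at (\<phi> x))"
      by (rule has_derivative_transform_within_open[of "\<lambda>z. 1" _ _ _ T])
        (use T nz in \<open>auto simp: unit_normal_def power2_norm_eq_inner[symmetric] power2_eq_square\<close>)
    ultimately have "(\<lambda>h. unit_normal K (\<phi> x) \<bullet> L h + L h \<bullet> unit_normal K (\<phi> x)) = (\<lambda>h. 0)"
      by (rule has_derivative_unique)
    then show ?thesis by (drule_tac x=h in fun_cong) (simp add: inner_commute)
  qed
  have NFn: "NF h \<bullet> n = 0" for h
  proof -
    have "NF h \<bullet> unit_normal F (\<phi> x) = 0"
      by (rule unit[OF NF opU]) (use x F0 in \<open>auto simp: \<phi>_def\<close>)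
    moreover have "s \<noteq> 0" using c0[OF xE] by (simp add: s_def sgn_if)
    ultimately show ?thesis using N[OF xE'] by (simp add: n_def)
  qed
  have NGn: "NG h \<bullet> n = 0" for h
    unfolding n_def
    by (rule unit[OF NG, of "D \<times> UNIV"])
      (use x opD gG in \<open>auto simp: \<phi>_def open_Times zero_prod_def\<close>)
  define A where "A = (\<lambda>h. NF h - s *\<^sub>R NG h)"
  have linA: "linear A"
    unfolding A_def using NF NG
    by (intro linear_compose_sub linear_compose_scale_right has_derivative_linear)
  have tang: "A (h, h \<bullet> gradient u x) = 0" for h
  proof -
    have "((\<lambda>y. unit_normal F (\<phi> y)) has_derivative (\<lambda>h. NF (h, h \<bullet> gradient u x))) (at x)"
      using has_derivative_compose[OF D\<phi>[OF x(1)] NF] .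
    moreover have "((\<lambda>y. unit_normal F (\<phi> y)) has_derivative (\<lambda>h. s *\<^sub>R NG (h, h \<bullet> gradient u x))) (at x)"
      by (rule has_derivative_transform_within_open
          [OF has_derivative_scaleR_right[OF has_derivative_compose[OF D\<phi>[OF x(1)] NG]] opE' xE'])
        (simp add: N)
    ultimately have "(\<lambda>h. NF (h, h \<bullet> gradient u x)) = (\<lambda>h. s *\<^sub>R NG (h, h \<bullet> gradient u x))"
      by (rule has_derivative_unique)
    then show ?thesis by (drule_tac x=h in fun_cong) (simp add: A_def)
  qed
  have "gradient G (\<phi> x) \<noteq> 0" using gx by (simp add: zero_prod_def)
  then have "norm n = 1" unfolding n_def unit_normal_def by simp
  then have nn: "n \<bullet> n = 1" by (simp add: norm_eq_1)
  have Ah: "A h = (h \<bullet> n) *\<^sub>R A n" for h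
  proof -
    define k where "k = h - (h \<bullet> n) *\<^sub>R n"
    have "k \<bullet> n = 0" by (simp add: k_def nn inner_diff_left)
    then have "k \<bullet> gradient G (\<phi> x) = 0"
      using \<open>gradient G (\<phi> x) \<noteq> 0\<close> by (simp add: n_def unit_normal_def)
    then have "k = (fst k, fst k \<bullet> gradient u x)"
      using gx by (simp add: inner_prod_def prod_eq_iff)
    then have "A k = 0" using tang by metis
    then show ?thesis
      by (simp add: k_def linear_diff[OF linA] linear_scale[OF linA])
  qed
  have "(\<Sum>b\<in>Basis. A b \<bullet> b) = (\<Sum>b\<in>Basis. (n \<bullet> b) * (A n \<bullet> b))"
    by (subst Ah) (simp add: inner_commute)
  also have "\<dots> = n \<bullet> A n" by (simp add: euclidean_inner[symmetric])
  also have "\<dots> = 0"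
    using NFn[of n] NGn[of n] by (simp add: A_def inner_diff_right inner_commute)
  finally have "(\<Sum>b\<in>Basis. NF b \<bullet> b) = s * (\<Sum>b\<in>Basis. NG b \<bullet> b)"
    by (simp add: A_def inner_diff_left sum_subtractf sum_distrib_left)
  moreover have "(\<Sum>b\<in>Basis. NF b \<bullet> b) = 0"
    using 0 divergence_eqI[OF NF] by (simp add: \<phi>_def)
  moreover have "s \<noteq> 0" using c0[OF xE] by (simp add: s_def sgn_if)
  ultimately show ?thesis
    using divergence_eqI[OF NG] by (simp add: \<phi>_def G_def)
qed

theorem minimal_hypersurface_graph_iff:
  fixes u :: "'a::euclidean_space \<Rightarrow> real"
  assumes u: "C2_on D u"
  shows "minimal_hypersurface (graph_on D u) \<longleftrightarrow>
    (\<forall>x\<in>D. divergence (\<lambda>y. gradient u y /\<^sub>R sqrt (1 + (norm (gradient u y))\<^sup>2)) x = 0)"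
    (is "?L \<longleftrightarrow> ?R")
proof
  assume ?L
  show ?R
  proof
    fix x assume x: "x \<in> D"
    then have "(x, u x) \<in> graph_on D u" by (auto simp: graph_on_def)
    with \<open>?L\<close> obtain U F where F: "(x, u x) \<in> U" "local_equation (graph_on D u) U F"
      "mean_curvature F (x, u x) = 0"
      unfolding minimal_hypersurface_def by blast
    then have "divergence (unit_normal F) (x, u x) = 0"
      by (simp add: mean_curvature_def)
    then have "divergence (unit_normal (\<lambda>p. snd p - u (fst p))) (x, u x) = 0"
      using local_equation_mean_curvature[OF u F(2) x F(1)] by blast
    then show "divergence (\<lambda>y. gradient u y /\<^sub>R sqrt (1 + (norm (gradient u y))\<^sup>2)) x = 0"
      using graph_divergence[OF u x] by simp
  qed
next
  assume ?R
  then have "mean_curvature (\<lambda>p. snd p - u (fst p)) p = 0" if "p \<in> graph_on D u" for p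
    using that graph_divergence[OF u] by (auto simp: graph_on_def mean_curvature_def)
  moreover have "p \<in> D \<times> UNIV" if "p \<in> graph_on D u" for p
    using that by (auto simp: graph_on_def)
  ultimately show ?L
    unfolding minimal_hypersurface_def using local_equation_graph[OF u] by blast
qed

end

theory Submission
  imports Defs
begin

text \<open>Write \<open>g\<close> for the gradient of a \<open>C\<^sup>2\<close> function \<open>u\<close> and \<open>H\<close> for the derivative of \<open>g\<close>. Carrying
  out the differentiation in the minimal surface equation turns it into the algebraic identity
  \<open>(1 + \<parallel>g\<parallel>\<^sup>2) tr H = g \<bullet> H g\<close> (lemma \<open>minimal_hypersurface_graphI\<close>), whose two sides are the
  Laplacian, up to a factor, and the infinity Laplacian of \<open>u\<close>. If both vanish, the identity is
  trivial; this is the first claim.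

  For the second claim put \<open>t = tan (f z)\<close>, \<open>s = 1 + t\<^sup>2 = tan' (f z)\<close> and \<open>G = \<parallel>g\<parallel>\<^sup>2\<close>, where \<open>g\<close> is
  now the gradient of \<open>f\<close> at \<open>z\<close>. The function \<open>u (z\<^sub>0, z) = z\<^sub>0 tan (f z)\<close> has gradient
  \<open>(t, z\<^sub>0 s g)\<close>, so that \<open>1 + \<parallel>\<nabla>u\<parallel>\<^sup>2 = s + z\<^sub>0\<^sup>2 s\<^sup>2 G\<close>. As \<open>\<Delta> f = 0\<close>, the trace of the Hessian of
  \<open>u\<close> reduces to \<open>2 z\<^sub>0 s t G\<close>, and as \<open>\<Delta>\<^sub>\<infinity> f = 0\<close>, its value on \<open>\<nabla>u\<close> reduces to
  \<open>2 z\<^sub>0 s\<^sup>2 t G + 2 z\<^sub>0\<^sup>3 s\<^sup>3 t G\<^sup>2\<close>, which is the product of the other two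
  (lemma \<open>minimal_hypersurface_graph_times_tan\<close>).\<close>

section \<open>Second derivatives\<close>

text \<open>In finite dimension the operator norm topology on linear maps is that of pointwise
  convergence. This makes it possible to check \<open>C\<^sup>2\<close> regularity on explicit formulas for the
  second derivative.\<close>

lemma C2_onI_pointwise:
  fixes F :: "'a::euclidean_space \<Rightarrow> real"
  assumes "open S"
    and g: "\<And>x. x \<in> S \<Longrightarrow> GDERIV F x :> g x"
    and H: "\<And>x. x \<in> S \<Longrightarrow> (g has_derivative H x) (at x)"
    and cont: "\<And>h. continuous_on S (\<lambda>x. H x h)"
  shows "C2_on S F"
proof -
  have app: "blinfun_apply (Blinfun (H x)) = H x" if "x \<in> S" for x
    using H[OF that] by (intro bounded_linear_Blinfun_apply has_derivative_bounded_linear)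
  have "continuous_on S (\<lambda>x. Blinfun (H x))"
  proof (rule continuous_on_blinfun_componentwise)
    fix i :: 'a
    show "continuous_on S (\<lambda>x. blinfun_apply (Blinfun (H x)) i)"
      using cont[of i] by (simp add: app cong: continuous_on_cong)
  qed
  then show ?thesis
    unfolding C2_on_def using assms(1) g H
    by (intro conjI exI[of _ g] exI[of _ "\<lambda>x. Blinfun (H x)"]) (auto simp: app)
qed

lemma C2_onE_pointwise:
  fixes F :: "'a::euclidean_space \<Rightarrow> real"
  assumes "C2_on S F"
  obtains H where
    "\<And>x. x \<in> S \<Longrightarrow> (gradient F has_derivative H x) (at x)"
    "\<And>h. continuous_on S (\<lambda>x. H x h)"
proof -
  obtain H where "\<And>x. x \<in> S \<Longrightarrow> (gradient F has_derivative blinfun_apply (H x)) (at x)"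
    and "continuous_on S H"
    by (rule C2_onE[OF assms]) (rule that)
  then show thesis
    by (intro that[of "\<lambda>x. blinfun_apply (H x)"]) (auto intro!: continuous_intros)
qed

lemma laplacian_eq_trace:
  assumes "(gradient F has_derivative H) (at x)"
  shows "laplacian F x = (\<Sum>b\<in>Basis. H b \<bullet> b)"
  unfolding laplacian_def by (rule divergence_eqI[OF assms])

text \<open>The gradient of \<open>\<parallel>\<nabla>F\<parallel>\<^sup>2 / 2\<close> is the adjoint of the Hessian applied to \<open>\<nabla>F\<close>. Pairing it with
  \<open>\<nabla>F\<close> moves the adjoint to the other side and leaves the Hessian itself.\<close>

lemma infinity_laplacian_eq_hessian:
  fixes F :: "'a::euclidean_space \<Rightarrow> real"
  assumes H: "(gradient F has_derivative H) (at x)"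
  shows "infinity_laplacian F x = gradient F x \<bullet> H (gradient F x)"
proof -
  have "((\<lambda>y. 1/2 * (gradient F y \<bullet> gradient F y)) has_derivative
      (\<lambda>h. gradient F x \<bullet> H h)) (at x)"
    by (rule has_derivative_eq_rhs, (rule derivative_intros H)+) (simp add: inner_commute)
  moreover have "gradient F x \<bullet> H h = h \<bullet> adjoint H (gradient F x)" for h
    using adjoint_works[OF has_derivative_linear[OF H], of h "gradient F x"]
    by (simp add: inner_commute)
  ultimately have "GDERIV (\<lambda>y. 1/2 * (norm (gradient F y))\<^sup>2) x :> adjoint H (gradient F x)"
    by (simp add: gderiv_def power2_norm_eq_inner)
  then have "infinity_laplacian F x = gradient F x \<bullet> adjoint H (gradient F x)"
    by (simp add: infinity_laplacian_def gradient_eqI)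
  also have "\<dots> = gradient F x \<bullet> H (gradient F x)"
    using adjoint_works[OF has_derivative_linear[OF H], of "gradient F x" "gradient F x"]
    by (simp add: inner_commute)
  finally show ?thesis .
qed

section \<open>The minimal surface equation in expanded form\<close>

text \<open>With \<open>w = sqrt (1 + \<parallel>g\<parallel>\<^sup>2)\<close>, the product rule for \<open>w\<inverse> g\<close> gives \<open>w\<inverse> tr H\<close> and, from the
  derivative of \<open>w\<inverse>\<close>, the trace of the rank one map \<open>h \<mapsto> - w\<^sup>-\<^sup>3 (g \<bullet> H h) g\<close>, which is
  \<open>- w\<^sup>-\<^sup>3 (g \<bullet> H g)\<close>.\<close>

lemma divergence_normalized_gradient:
  fixes u :: "'a::euclidean_space \<Rightarrow> real"
  assumes H: "(gradient u has_derivative H) (at x)"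
  shows "divergence (\<lambda>y. gradient u y /\<^sub>R sqrt (1 + (norm (gradient u y))\<^sup>2)) x =
    ((1 + (norm (gradient u x))\<^sup>2) * (\<Sum>b\<in>Basis. H b \<bullet> b) - gradient u x \<bullet> H (gradient u x))
      / sqrt (1 + (norm (gradient u x))\<^sup>2) ^ 3"
proof -
  define g where "g = gradient u x"
  define w where "w = sqrt (1 + g \<bullet> g)"
  have pos: "1 + g \<bullet> g > 0" by (simp add: add_pos_nonneg)
  then have w: "w > 0" "w\<^sup>2 = 1 + g \<bullet> g" by (simp_all add: w_def)
  have "((\<lambda>y. 1 + gradient u y \<bullet> gradient u y) has_derivative (\<lambda>h. 2 * (g \<bullet> H h))) (at x)"
    by (rule has_derivative_eq_rhs, (rule derivative_intros H)+)
      (simp add: inner_commute g_def)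
  from has_derivative_real_sqrt[OF _ this]
  have "((\<lambda>y. sqrt (1 + gradient u y \<bullet> gradient u y)) has_derivative (\<lambda>h. (g \<bullet> H h) / w)) (at x)"
    using pos by (simp add: g_def w_def field_simps)
  from Deriv.has_derivative_inverse[OF _ this]
  have "((\<lambda>y. inverse (sqrt (1 + gradient u y \<bullet> gradient u y))) has_derivative
      (\<lambda>h. - (g \<bullet> H h) / w ^ 3)) (at x)"
    using w(1) by (simp add: g_def w_def field_simps power3_eq_cube)
  from has_derivative_scaleR[OF this H]
  have "divergence (\<lambda>y. gradient u y /\<^sub>R sqrt (1 + gradient u y \<bullet> gradient u y)) x =
      (\<Sum>b\<in>Basis. (inverse w *\<^sub>R H b + (- (g \<bullet> H b) / w ^ 3) *\<^sub>R g) \<bullet> b)"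
    by (intro divergence_eqI) (simp add: g_def w_def)
  also have "\<dots> = inverse w * (\<Sum>b\<in>Basis. H b \<bullet> b) - (\<Sum>b\<in>Basis. (g \<bullet> b) * (g \<bullet> H b)) / w ^ 3"
    by (simp add: inner_add_left inner_diff_left sum_subtractf sum_distrib_left
        sum_divide_distrib mult.commute)
  also have "(\<Sum>b\<in>Basis. (g \<bullet> b) * (g \<bullet> H b)) = g \<bullet> H (\<Sum>b\<in>Basis. (g \<bullet> b) *\<^sub>R b)"
    using has_derivative_linear[OF H] by (simp add: linear_sum linear_scale inner_sum_right)
  also have "(\<Sum>b\<in>Basis. (g \<bullet> b) *\<^sub>R b) = g" by (rule euclidean_representation)
  also have "inverse w * (\<Sum>b\<in>Basis. H b \<bullet> b) - (g \<bullet> H g) / w ^ 3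
      = (w\<^sup>2 * (\<Sum>b\<in>Basis. H b \<bullet> b) - g \<bullet> H g) / w ^ 3"
    using w(1) by (simp add: field_simps power2_eq_square power3_eq_cube)
  finally show ?thesis
    unfolding power2_norm_eq_inner g_def[symmetric] w_def[symmetric] w(2) .
qed

lemma minimal_hypersurface_graphI:
  fixes u :: "'a::euclidean_space \<Rightarrow> real"
  assumes "C2_on D u"
    and "\<And>x. x \<in> D \<Longrightarrow> (gradient u has_derivative H x) (at x)"
    and "\<And>x. x \<in> D \<Longrightarrow>
      (1 + (norm (gradient u x))\<^sup>2) * (\<Sum>b\<in>Basis. H x b \<bullet> b) = gradient u x \<bullet> H x (gradient u x)"
  shows "minimal_hypersurface (graph_on D u)"
  unfolding minimal_hypersurface_graph_iff[OF assms(1)]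
  by (simp add: divergence_normalized_gradient[OF assms(2)] assms(3))

lemma minimal_hypersurface_graph_harmonic_infinity_harmonic:
  fixes f :: "'a::euclidean_space \<Rightarrow> real"
  assumes f: "C2_on \<Omega> f"
    and "\<And>z. z \<in> \<Omega> \<Longrightarrow> laplacian f z = 0"
    and "\<And>z. z \<in> \<Omega> \<Longrightarrow> infinity_laplacian f z = 0"
  shows "minimal_hypersurface (graph_on \<Omega> f)"
proof -
  obtain H where H: "\<And>z. z \<in> \<Omega> \<Longrightarrow> (gradient f has_derivative H z) (at z)"
    by (rule C2_onE_pointwise[OF f]) (rule that)
  show ?thesis
  proof (rule minimal_hypersurface_graphI[OF f H])
    fix z assume "z \<in> \<Omega>"
    with assms show "(1 + (norm (gradient f z))\<^sup>2) * (\<Sum>b\<in>Basis. H z b \<bullet> b)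
        = gradient f z \<bullet> H z (gradient f z)"
      using laplacian_eq_trace[OF H] infinity_laplacian_eq_hessian[OF H] by simp
  qed
qed

section \<open>The graph of \<open>z\<^sub>0 tan f\<close>\<close>

lemma sum_Basis_real_prod:
  fixes A :: "real \<times> 'a::euclidean_space \<Rightarrow> real"
  shows "(\<Sum>b\<in>Basis. A b) = A (1, 0) + (\<Sum>b\<in>Basis. A (0, b))"
proof -
  have "inj_on (\<lambda>v::'a. (0::real, v)) Basis" by (simp add: inj_on_def)
  then show ?thesis
    unfolding Basis_prod_def
    by (subst sum.union_disjoint) (auto simp: sum.reindex)
qed

lemma one_plus_tan_squared: "cos x \<noteq> 0 \<Longrightarrow> inverse ((cos x)\<^sup>2) = 1 + (tan x)\<^sup>2" for x :: real
  by (simp add: tan_sec power_inverse)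

text \<open>The derivative at \<open>p = (z\<^sub>0, z)\<close>, in direction \<open>h\<close>, of the gradient of \<open>z\<^sub>0 tan (f z)\<close>; here
  \<open>H\<close> stands for the derivative of the gradient of \<open>f\<close>. The derivative of \<open>tan\<close> is written as
  \<open>1 + tan\<^sup>2\<close>, so that everything is polynomial in \<open>z\<^sub>0\<close>, \<open>tan f\<close> and the derivatives of \<open>f\<close>.\<close>

definition times_tan_hessian ::
  "('a::euclidean_space \<Rightarrow> real) \<Rightarrow> ('a \<Rightarrow> 'a \<Rightarrow> 'a) \<Rightarrow> real \<times> 'a \<Rightarrow> real \<times> 'a \<Rightarrow> real \<times> 'a" where
  "times_tan_hessian f H p h =
    (let z\<^sub>0 = fst p; z = snd p; t = tan (f z); s = 1 + t\<^sup>2; g = gradient f z; d = snd h \<bullet> g in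
      (s * d, (fst h * s + z\<^sub>0 * (2 * t * s * d)) *\<^sub>R g + (z\<^sub>0 * s) *\<^sub>R H z (snd h)))"

lemma
  fixes f :: "'a::euclidean_space \<Rightarrow> real"
  assumes f: "C2_on \<Omega> f"
    and H: "\<And>z. z \<in> \<Omega> \<Longrightarrow> (gradient f has_derivative H z) (at z)"
    and cont: "\<And>h. continuous_on \<Omega> (\<lambda>z. H z h)"
  defines "D \<equiv> UNIV \<times> {z\<in>\<Omega>. cos (f z) \<noteq> 0}"
    and "u \<equiv> \<lambda>p::real \<times> 'a. fst p * tan (f (snd p))"
  shows C2_on_times_tan: "C2_on D u"
    and gradient_times_tan: "p \<in> D \<Longrightarrow> gradient u p =
      (tan (f (snd p)), (fst p * (1 + (tan (f (snd p)))\<^sup>2)) *\<^sub>R gradient f (snd p))"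
    and hessian_times_tan: "p \<in> D \<Longrightarrow> (gradient u has_derivative times_tan_hessian f H p) (at p)"
proof -
  define V where "V = (\<lambda>p::real \<times> 'a.
    (tan (f (snd p)), (fst p * (1 + (tan (f (snd p)))\<^sup>2)) *\<^sub>R gradient f (snd p)))"
  have "open \<Omega>" using f by (simp add: C2_on_def)
  have contf: "continuous_on \<Omega> f"
    by (rule has_derivative_continuous_on[OF has_derivative_at_withinI[OF C2_on_has_derivative[OF f]]])
  have "open (\<Omega> \<inter> (\<lambda>z. cos (f z)) -` (- {0}))"
    using \<open>open \<Omega>\<close> contf by (intro continuous_open_preimage continuous_intros) auto
  also have "\<Omega> \<inter> (\<lambda>z. cos (f z)) -` (- {0}) = {z\<in>\<Omega>. cos (f z) \<noteq> 0}" by auto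
  finally have opD: "open D" by (simp add: D_def open_Times)
  have DD: "snd p \<in> \<Omega>" "cos (f (snd p)) \<noteq> 0" if "p \<in> D" for p using that by (auto simp: D_def)
  have Dtan: "((\<lambda>q. tan (f (snd q))) has_derivative
      (\<lambda>h. (1 + (tan (f (snd p)))\<^sup>2) * (snd h \<bullet> gradient f (snd p)))) (at p)"
    if "p \<in> D" for p :: "real \<times> 'a"
  proof -
    have "((\<lambda>q. f (snd q)) has_derivative (\<lambda>h. snd h \<bullet> gradient f (snd p))) (at p)"
      using has_derivative_compose[OF has_derivative_snd[OF has_derivative_ident]
          C2_on_has_derivative[OF f DD(1)[OF that]]] .
    from has_derivative_compose[OF this DERIV_tan[OF DD(2)[OF that], unfolded has_field_derivative_def]]
    show ?thesis by (simp add: one_plus_tan_squared DD(2)[OF that])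
  qed
  have Dg: "((\<lambda>q. gradient f (snd q)) has_derivative (\<lambda>h. H (snd p) (snd h))) (at p)"
    if "p \<in> D" for p :: "real \<times> 'a"
    using has_derivative_compose[OF has_derivative_snd[OF has_derivative_ident] H[OF DD(1)[OF that]]] .
  have gu: "GDERIV u p :> V p" if "p \<in> D" for p
    unfolding gderiv_def u_def
    by (rule has_derivative_eq_rhs, (rule derivative_intros Dtan that)+)
      (simp add: V_def inner_prod_def algebra_simps fun_eq_iff)
  then have gu': "gradient u p = V p" if "p \<in> D" for p
    using that gradient_eqI by blast
  have HV: "(V has_derivative times_tan_hessian f H p) (at p)" if "p \<in> D" for p
    unfolding V_def power2_eq_square
    by (rule has_derivative_eq_rhs, (rule derivative_intros Dtan Dg that)+)
      (simp add: times_tan_hessian_def Let_def fun_eq_iff power2_eq_square algebra_simps)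
  have cs: "continuous_on D (\<lambda>p. k (snd p))" if "continuous_on \<Omega> k"
    for k :: "'a \<Rightarrow> 'b::topological_space"
    by (rule continuous_on_compose2[OF that continuous_on_snd[OF continuous_on_id]])
      (auto simp: D_def)
  have "continuous_on D (\<lambda>p. tan (f (snd p)))"
    by (rule has_derivative_continuous_on[OF has_derivative_at_withinI[OF Dtan]])
  then have contK: "continuous_on D (\<lambda>p. times_tan_hessian f H p h)" for h
    unfolding times_tan_hessian_def Let_def
    by (intro continuous_intros cs[OF cont] cs[OF C2_on_continuous_gradient[OF f]])
  show "C2_on D u" by (rule C2_onI_pointwise[OF opD gu HV contK])
  show "p \<in> D \<Longrightarrow> gradient u p =
      (tan (f (snd p)), (fst p * (1 + (tan (f (snd p)))\<^sup>2)) *\<^sub>R gradient f (snd p))"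
    by (simp add: gu' V_def)
  show "(gradient u has_derivative times_tan_hessian f H p) (at p)" if "p \<in> D"
    by (rule has_derivative_transform_within_open[OF HV[OF that] opD that]) (simp add: gu')
qed

lemma minimal_hypersurface_graph_times_tan:
  fixes f :: "'a::euclidean_space \<Rightarrow> real"
  assumes f: "C2_on \<Omega> f"
    and lap: "\<And>z. z \<in> \<Omega> \<Longrightarrow> laplacian f z = 0"
    and inf: "\<And>z. z \<in> \<Omega> \<Longrightarrow> infinity_laplacian f z = 0"
  shows "minimal_hypersurface
    (graph_on (UNIV \<times> {z\<in>\<Omega>. cos (f z) \<noteq> 0}) (\<lambda>p::real \<times> 'a. fst p * tan (f (snd p))))"
proof -
  obtain H where H: "\<And>z. z \<in> \<Omega> \<Longrightarrow> (gradient f has_derivative H z) (at z)"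
    and cont: "\<And>h. continuous_on \<Omega> (\<lambda>z. H z h)"
    by (rule C2_onE_pointwise[OF f]) (rule that)
  show ?thesis
  proof (rule minimal_hypersurface_graphI
      [OF C2_on_times_tan[OF f H cont] hessian_times_tan[OF f H cont]])
    fix p :: "real \<times> 'a"
    assume p: "p \<in> UNIV \<times> {z\<in>\<Omega>. cos (f z) \<noteq> 0}"
    define z0 z where "z0 = fst p" and "z = snd p"
    define t g where "t = tan (f z)" and "g = gradient f z"
    define s where "s = 1 + t\<^sup>2"
    have z: "z \<in> \<Omega>" using p by (auto simp: z_def)
    have lin: "linear (H z)" by (rule has_derivative_linear[OF H[OF z]])
    have tr0: "(\<Sum>b\<in>Basis. H z b \<bullet> b) = 0"
      using laplacian_eq_trace[OF H[OF z]] lap[OF z] by simp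
    have gHg: "g \<bullet> H z g = 0"
      using infinity_laplacian_eq_hessian[OF H[OF z]] inf[OF z] by (simp add: g_def)
    have G: "(\<Sum>b\<in>Basis. (b \<bullet> g) * (g \<bullet> b)) = g \<bullet> g"
      by (simp add: euclidean_inner[of g g] inner_commute)
    define K where "K = (\<lambda>h. (s * (snd h \<bullet> g),
        (fst h * s + z0 * (2 * t * s * (snd h \<bullet> g))) *\<^sub>R g + (z0 * s) *\<^sub>R H z (snd h)))"
    have "(\<Sum>b\<in>Basis. K b \<bullet> b)
        = (\<Sum>b\<in>Basis. 2 * z0 * s * t * ((b \<bullet> g) * (g \<bullet> b)) + z0 * s * (H z b \<bullet> b))"
      unfolding sum_Basis_real_prod[of "\<lambda>b. K b \<bullet> b"]
      by (simp add: K_def inner_prod_def inner_add_left algebra_simps)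
    also have "\<dots> = 2 * z0 * s * t * (g \<bullet> g)"
      by (simp only: sum.distrib sum_distrib_left[symmetric] tr0 G mult_zero_right add_0_right)
    finally have trace: "(\<Sum>b\<in>Basis. K b \<bullet> b) = 2 * z0 * s * t * (g \<bullet> g)" .
    have norm: "1 + (norm (t, (z0 * s) *\<^sub>R g))\<^sup>2 = s + z0\<^sup>2 * s\<^sup>2 * (g \<bullet> g)"
      unfolding power2_norm_eq_inner
      by (simp add: inner_prod_def power2_eq_square s_def algebra_simps)
    have "(t, (z0 * s) *\<^sub>R g) \<bullet> K (t, (z0 * s) *\<^sub>R g)
        = 2 * z0 * s\<^sup>2 * t * (g \<bullet> g) + 2 * z0 ^ 3 * s ^ 3 * t * (g \<bullet> g)\<^sup>2
          + z0 ^ 3 * s ^ 3 * (g \<bullet> H z g)"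
      by (simp add: K_def inner_prod_def inner_add_right linear_scale[OF lin]
          power2_eq_square power3_eq_cube algebra_simps)
    then have "(1 + (norm (t, (z0 * s) *\<^sub>R g))\<^sup>2) * (\<Sum>b\<in>Basis. K b \<bullet> b)
        = (t, (z0 * s) *\<^sub>R g) \<bullet> K (t, (z0 * s) *\<^sub>R g)"
      unfolding norm trace gHg
      by (simp add: power2_eq_square power3_eq_cube algebra_simps)
    moreover have "times_tan_hessian f H p = K"
      by (simp add: fun_eq_iff times_tan_hessian_def Let_def K_def s_def t_def g_def z0_def z_def)
    moreover have "gradient (\<lambda>p. fst p * tan (f (snd p))) p = (t, (z0 * s) *\<^sub>R g)"
      using gradient_times_tan[OF f H cont p] by (simp add: s_def t_def g_def z0_def z_def)
    ultimately show "(1 + (norm (gradient (\<lambda>p. fst p * tan (f (snd p))) p))\<^sup>2) *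
        (\<Sum>b\<in>Basis. times_tan_hessian f H p b \<bullet> b)
      = gradient (\<lambda>p. fst p * tan (f (snd p))) p \<bullet>
        times_tan_hessian f H p (gradient (\<lambda>p. fst p * tan (f (snd p))) p)"
      by simp
  qed
qed

theorem theorem2:
  fixes f :: "real ^ 'n \<Rightarrow> real" and \<Omega> :: "(real ^ 'n) set"
  assumes "open \<Omega>"
    and "C2_on \<Omega> f"
    and "\<forall>z\<in>\<Omega>. laplacian f z = 0"
    and "\<forall>z\<in>\<Omega>. infinity_laplacian f z = 0"
  shows "minimal_hypersurface (graph_on \<Omega> f)
    \<and> minimal_hypersurface
        (graph_on {(z\<^sub>0, z). z \<in> \<Omega> \<and> cos (f z) \<noteq> 0} (\<lambda>(z\<^sub>0 :: real, z). z\<^sub>0 * tan (f z)))"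
proof -
  have "{(z\<^sub>0::real, z). z \<in> \<Omega> \<and> cos (f z) \<noteq> 0} = UNIV \<times> {z\<in>\<Omega>. cos (f z) \<noteq> 0}"
    by auto
  then show ?thesis
    using minimal_hypersurface_graph_harmonic_infinity_harmonic[of \<Omega> f]
      minimal_hypersurface_graph_times_tan[of \<Omega> f] assms(2-4)
    by (simp add: case_prod_unfold)
qed

end
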